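(* Let $n$ and $a_1,\ldots,a_m$ be positive integers and let $S=S(a_1,\ldots,a_m)=\{\sum_{i=1}^m x_ia_i : x_1,\ldots,x_m\in\{0,1,2,\ldots\}\}$. Then the following two sets have the same cardinality: (i) the set of partitions of $n$ in which each part lies in $S$ and each difference $\lambda-\mu\ge 0$ between two parts $\lambda,\mu$ lies in $S$; (ii) the set of partitions of $n$ in which each part appears with multiplicity lying in $S$. Moreover, suppose $a_1,\ldots,a_m$ satisfy the condition ( * ) for every $i=2,\ldots,m$ there exists $j<i$ such that $\operatorname{lcm}(\gcd(a_1,\ldots,a_{i-1}),a_i)=\operatorname{lcm}(a_j,a_i)$. Then the sets in (i) and (ii) also have the same cardinality as (iii) the set of partitions of $n$ in which each part is divisible by some $a_i$, $1\le i\le m$.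
   Context: A partition of $n$ is an unordered multiset of positive integers (parts) whose sum is $n$. The multiplicity of a part is the number of times it occurs in the multiset. $\gcd$ and $\operatorname{lcm}$ denote greatest common divisor and least common multiple. *)

theory Defs
  imports Main "HOL-Library.Multiset"
begin

definition partitions :: "nat \<Rightarrow> nat multiset set" where
  "partitions n = {P. (\<forall>p\<in>#P. 0 < p) \<and> sum_mset P = n}"

(* The generators are a 1, ..., a m; values of a outside {1..m} are irrelevant. *)
definition gen_semigroup :: "nat \<Rightarrow> (nat \<Rightarrow> nat) \<Rightarrow> nat set" where
  "gen_semigroup m a = {(\<Sum>i=1..m. x i * a i) | x :: nat \<Rightarrow> nat. True}"

(* The condition mu <= la keeps the truncated subtraction on nat honest. *)
definition parts_diffs_partitions :: "nat \<Rightarrow> nat set \<Rightarrow> nat multiset set" where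
  "parts_diffs_partitions n S =
     {P \<in> partitions n. (\<forall>la\<in>#P. la \<in> S) \<and>
        (\<forall>la\<in>#P. \<forall>mu\<in>#P. mu \<le> la \<longrightarrow> la - mu \<in> S)}"

definition mult_partitions :: "nat \<Rightarrow> nat set \<Rightarrow> nat multiset set" where
  "mult_partitions n S = {P \<in> partitions n. \<forall>p\<in>#P. count P p \<in> S}"

definition divisible_partitions :: "nat \<Rightarrow> nat \<Rightarrow> (nat \<Rightarrow> nat) \<Rightarrow> nat multiset set" where
  "divisible_partitions n m a = {P \<in> partitions n. \<forall>p\<in>#P. \<exists>i\<in>{1..m}. a i dvd p}"

definition lcm_gcd_condition :: "nat \<Rightarrow> (nat \<Rightarrow> nat) \<Rightarrow> bool" where
  "lcm_gcd_condition m a \<longleftrightarrow>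
     (\<forall>i\<in>{2..m}. \<exists>j\<in>{1..<i}. lcm (Gcd (a ` {1..<i})) (a i) = lcm (a j) (a i))"

(* Every set of partitions above is therefore finite, so comparing card is meaningful. *)
lemma finite_partitions: "finite (partitions n)"
proof (rule finite_subset)
  show "partitions n \<subseteq> (\<Union>k\<le>n. multisets_of_size {..n} k)"
  proof
    fix P assume P: "P \<in> partitions n"
    have "size Q \<le> sum_mset Q \<and> set_mset Q \<subseteq> {..sum_mset Q}"
      if "\<forall>p\<in>#Q. 0 < p" for Q :: "nat multiset"
      using that by (induction Q) fastforce+
    with P show "P \<in> (\<Union>k\<le>n. multisets_of_size {..n} k)"
      by (auto simp: partitions_def multisets_of_size_def)
  qed
  show "finite (\<Union>k\<le>n. multisets_of_size {..n} k)"
    by (intro finite_UN_I finite_atMost finite_multisets_of_size)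
qed

end

theory Submission
  imports Defs "HOL-Computational_Algebra.Formal_Power_Series"
begin

text \<open>Since \<open>S\<close> is closed under addition, (i) only constrains the differences of consecutive
  parts, which are the multiplicities in the conjugate partition; this gives (i) = (ii).
  For (iii), let \<open>S\<^sub>i\<close> be generated by \<open>a\<^sub>1, \<dots>, a\<^sub>i\<close> and put \<open>l\<^sub>i = lcm (gcd (a\<^sub>1, \<dots>, a\<^sub>i\<^sub>-\<^sub>1), a\<^sub>i)\<close>.
  The condition places \<open>l\<^sub>i\<close> in \<open>S\<^sub>i\<^sub>-\<^sub>1\<close>, and then \<open>S\<^sub>i - (a\<^sub>i + S\<^sub>i) = S\<^sub>i\<^sub>-\<^sub>1 - (l\<^sub>i + S\<^sub>i\<^sub>-\<^sub>1)\<close>, so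
  the generating function of \<open>S\<^sub>i\<close> is that of \<open>S\<^sub>i\<^sub>-\<^sub>1\<close> times \<open>(1 - q^l\<^sub>i) / (1 - q^a\<^sub>i)\<close>.
  Replacing \<open>q\<close> by \<open>q^k\<close> and taking the product over all \<open>k\<close> adjoins a factor \<open>1 / (1 - q^p)\<close> for
  every multiple \<open>p\<close> of \<open>a\<^sub>i\<close> and removes one for every multiple of \<open>l\<^sub>i\<close>. The condition also says that
  the multiples of \<open>l\<^sub>i\<close> are exactly the multiples of \<open>a\<^sub>i\<close> divisible by an earlier generator,
  so this is inclusion-exclusion for the set of admissible parts.\<close>

section \<open>Multisets with prescribed multiplicities\<close>

text \<open>Common form of (ii) and (iii): \<open>K = {1..n}\<close> with multiplicities in the
  semigroup, or \<open>K\<close> the admissible parts with \<open>S = UNIV\<close>. Quantifying over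
  \<open>K\<close> rather than over the occurring parts gives each \<open>k\<close> an independent
  choice of multiplicity, hence a product generating function.\<close>

definition restricted_partitions :: "nat set \<Rightarrow> nat set \<Rightarrow> nat \<Rightarrow> nat multiset set" where
  "restricted_partitions K S n =
     {P. set_mset P \<subseteq> K \<and> (\<forall>k\<in>K. count P k \<in> S) \<and> sum_mset P = n}"

lemma finite_restricted_partitions:
  assumes "0 \<notin> K"
  shows "finite (restricted_partitions K S n)"
proof (rule finite_subset[OF _ finite_partitions])
  have "0 < p" if "p \<in> K" for p
    using that assms by (cases p) auto
  then show "restricted_partitions K S n \<subseteq> partitions n"
    unfolding restricted_partitions_def partitions_def by auto
qed

lemma filter_plus_replicate_count:
  "filter_mset (\<lambda>x. x \<noteq> k) P + replicate_mset (count P k) k = P"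
  by (rule multiset_eqI) auto

text \<open>Splits off all \<open>s\<close> copies of \<open>k\<close>. This recursion is matched
  twice: by subtracting the minimum in the conjugation argument, and by the Cauchy product with the
  factor for \<open>k\<close>.\<close>

lemma card_restricted_partitions_insert:
  assumes "k \<notin> K" "0 < k" "0 \<notin> K"
  shows "card (restricted_partitions (insert k K) S n) =
    (\<Sum>s | s \<in> S \<and> k * s \<le> n. card (restricted_partitions K S (n - k * s)))"
proof -
  let ?B = "{s. s \<in> S \<and> k * s \<le> n}"
  let ?f = "\<lambda>(s, P). P + replicate_mset s k"
  let ?g = "\<lambda>P. (count P k, filter_mset (\<lambda>x. x \<noteq> k) P)"
  have fin: "finite ?B"
  proof (rule finite_subset)
    show "?B \<subseteq> {..n}"
    proof
      fix s assume "s \<in> ?B"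
      moreover have "s \<le> k * s" using assms(2) by simp
      ultimately show "s \<in> {..n}" using le_trans by blast
    qed
  qed simp
  have "bij_betw ?f (SIGMA s:?B. restricted_partitions K S (n - k * s))
          (restricted_partitions (insert k K) S n)"
  proof (rule bij_betw_byWitness[where f' = ?g])
    show "\<forall>x\<in>SIGMA s:?B. restricted_partitions K S (n - k * s). ?g (?f x) = x"
    proof
      fix x assume "x \<in> (SIGMA s:?B. restricted_partitions K S (n - k * s))"
      then obtain s P where x: "x = (s, P)" and "P \<in> restricted_partitions K S (n - k * s)"
        by auto
      then have "k \<notin># P" using assms(1) by (auto simp: restricted_partitions_def)
      then have "count P k = 0" by (simp add: not_in_iff)
      moreover have "filter_mset (\<lambda>x. x \<noteq> k) (P + replicate_mset s k) = P"
        using \<open>count P k = 0\<close> by (intro multiset_eqI) auto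
      ultimately show "?g (?f x) = x" by (simp add: x)
    qed
    show "\<forall>P\<in>restricted_partitions (insert k K) S n. ?f (?g P) = P"
      by (simp add: filter_plus_replicate_count)
    show "?f ` (SIGMA s:?B. restricted_partitions K S (n - k * s))
        \<subseteq> restricted_partitions (insert k K) S n"
    proof clarify
      fix s P assume s: "s \<in> S" "k * s \<le> n"
        and P: "P \<in> restricted_partitions K S (n - k * s)"
      from P have "k \<notin># P" using assms(1) by (auto simp: restricted_partitions_def)
      then have "count P k = 0" by (simp add: not_in_iff)
      with s P assms(1) show "P + replicate_mset s k \<in> restricted_partitions (insert k K) S n"
        by (auto simp: restricted_partitions_def
            split: if_splits)
    qed
    show "?g ` restricted_partitions (insert k K) S n
        \<subseteq> (SIGMA s:?B. restricted_partitions K S (n - k * s))"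
    proof (rule image_subsetI)
      fix P assume P: "P \<in> restricted_partitions (insert k K) S n"
      have "sum_mset (filter_mset (\<lambda>x. x \<noteq> k) P + replicate_mset (count P k) k) = n"
        using P by (simp only: filter_plus_replicate_count) (simp add: restricted_partitions_def)
      then have "sum_mset (filter_mset (\<lambda>x. x \<noteq> k) P) + k * count P k = n"
        by (simp add: mult.commute)
      with P assms(1) show "?g P \<in> (SIGMA s:?B. restricted_partitions K S (n - k * s))"
        by (auto simp: restricted_partitions_def)
    qed
  qed
  from bij_betw_same_card[OF this] show ?thesis
    using fin finite_restricted_partitions[OF assms(3)] by (subst (asm) card_SigmaI) auto
qed

section \<open>Conjugation\<close>

text \<open>Fixing the size and allowing zeros makes induction on \<open>K\<close> possible; padding
  later recovers (i) from \<open>K = n\<close>.\<close>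

definition difference_multisets :: "nat \<Rightarrow> nat set \<Rightarrow> nat \<Rightarrow> nat multiset set" where
  "difference_multisets K S n = {M. size M = K \<and> sum_mset M = n \<and> set_mset M \<subseteq> S \<and>
     (\<forall>x\<in>#M. \<forall>y\<in>#M. y \<le> x \<longrightarrow> x - y \<in> S)}"

lemma finite_difference_multisets: "finite (difference_multisets K S n)"
proof (rule finite_subset)
  show "difference_multisets K S n \<subseteq> multisets_of_size {..n} K"
  proof
    fix M assume "M \<in> difference_multisets K S n"
    then have "size M = K" "sum_mset M = n" by (auto simp: difference_multisets_def)
    moreover have "x \<le> sum_mset M" if "x \<in># M" for x
      using multi_member_split[OF that] by auto
    ultimately show "M \<in> multisets_of_size {..n} K"
      by (auto simp: multisets_of_size_def)
  qed
qed (intro finite_multisets_of_size finite_atMost)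

lemma sum_mset_image_add:
  "sum_mset (image_mset ((+) (s::nat)) M) = size M * s + sum_mset M"
  by (induction M) auto

text \<open>Subtracting the least element \<open>s\<close> from all \<open>K + 1\<close> elements and dropping one resulting
  \<open>0\<close> is the conjugate of deleting the \<open>s\<close> copies of the part \<open>K + 1\<close>.\<close>

lemma card_difference_multisets_Suc:
  assumes "0 \<in> S" and add: "\<And>x y. x \<in> S \<Longrightarrow> y \<in> S \<Longrightarrow> x + y \<in> S"
  shows "card (difference_multisets (Suc K) S n) =
    (\<Sum>s | s \<in> S \<and> Suc K * s \<le> n. card (difference_multisets K S (n - Suc K * s)))"
proof -
  let ?B = "{s. s \<in> S \<and> Suc K * s \<le> n}"
  let ?f = "\<lambda>(s, M). image_mset ((+) s) (add_mset 0 M)"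
  let ?D = "SIGMA s:?B. difference_multisets K S (n - Suc K * s)"
  have fin: "finite ?B"
    by (rule finite_subset[of _ "{..n}"]) auto
  have "inj_on ?f ?D"
  proof (rule inj_onI, clarify)
    fix s M t N
    assume eq: "image_mset ((+) s) (add_mset 0 M) = image_mset ((+) t) (add_mset (0::nat) N)"
    \<comment> \<open>Because of the adjoined \<open>0\<close>, both \<open>s\<close> and
      \<open>t\<close> occur in the common multiset, and each is a lower bound of it, so they
      coincide.\<close>
    have "s \<in># image_mset ((+) t) (add_mset 0 N)"
      unfolding eq[symmetric] by simp
    moreover have "t \<in># image_mset ((+) s) (add_mset 0 M)"
      unfolding eq by simp
    ultimately have st: "s = t" by auto
    then have "image_mset ((+) s) M = image_mset ((+) s) N" using eq by simp
    moreover have "inj (image_mset ((+) s))" by (rule multiset.inj_map) simp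
    ultimately show "s = t \<and> M = N" using st by (auto dest: injD)
  qed
  moreover have "?f ` ?D = difference_multisets (Suc K) S n"
  proof (intro equalityI subsetI)
    fix P assume "P \<in> ?f ` ?D"
    then obtain s M where P: "P = image_mset ((+) s) (add_mset 0 M)"
      and s: "s \<in> S" "Suc K * s \<le> n" and M: "M \<in> difference_multisets K S (n - Suc K * s)"
      by auto
    have "size P = Suc K" "sum_mset P = n" "set_mset P \<subseteq> S"
      using M s add unfolding P sum_mset_image_add by (auto simp: difference_multisets_def)
    \<comment> \<open>Translation by \<open>s\<close> leaves differences unchanged, and a difference
      with the adjoined \<open>0\<close> is an element of \<open>M\<close> or
      \<open>0\<close>.\<close>
    moreover have "\<forall>x\<in>#P. \<forall>y\<in>#P. y \<le> x \<longrightarrow> x - y \<in> S"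
      using M assms(1) unfolding P by (auto simp: difference_multisets_def)
    ultimately show "P \<in> difference_multisets (Suc K) S n"
      by (simp add: difference_multisets_def)
  next
    fix P assume P: "P \<in> difference_multisets (Suc K) S n"
    define s where "s = Min (set_mset P)"
    have ne: "set_mset P \<noteq> {}" using P by (auto simp: difference_multisets_def)
    have sP: "s \<in># P" unfolding s_def using ne by (intro Min_in) auto
    have le: "s \<le> x" if "x \<in># P" for x unfolding s_def using that by (intro Min_le) auto
    define M where "M = image_mset (\<lambda>x. x - s) (P - {#s#})"
    have "image_mset ((+) s) M = image_mset (\<lambda>x. x) (P - {#s#})"
      unfolding M_def multiset.map_comp using le
      by (intro image_mset_cong) (auto dest: in_diffD)
    then have eq: "P = image_mset ((+) s) (add_mset 0 M)" using sP by simp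
    have size: "size M = K" using P eq sP unfolding M_def
      by (simp add: difference_multisets_def size_Diff_singleton)
    have "sum_mset P = Suc K * s + sum_mset M"
      by (subst eq) (simp only: sum_mset_image_add, simp add: size)
    then have sum: "Suc K * s + sum_mset M = n" using P by (simp add: difference_multisets_def)
    have inP: "s + x \<in># P" if "x \<in># M" for x
      by (subst eq) (use that in auto)
    \<comment> \<open>Each element of \<open>M\<close> is itself a difference in \<open>P\<close>,
      taken against the minimum.\<close>
    have "x \<in> S" if "x \<in># M" for x
    proof -
      have "(s + x) - s \<in> S" using P inP[OF that] sP le_add1 unfolding difference_multisets_def by blast
      then show ?thesis by simp
    qed
    moreover have "x - y \<in> S" if "x \<in># M" "y \<in># M" "y \<le> x" for x y
    proof -
      have "\<forall>x\<in>#P. \<forall>y\<in>#P. y \<le> x \<longrightarrow> x - y \<in> S"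
        using P by (simp add: difference_multisets_def)
      from this[rule_format, OF inP[OF that(1)] inP[OF that(2)]] that(3)
      have "(s + x) - (s + y) \<in> S" by simp
      then show ?thesis by simp
    qed
    moreover have "s \<in> S" using P sP by (auto simp: difference_multisets_def)
    ultimately have "(s, M) \<in> ?D"
      using size sum by (auto simp: difference_multisets_def)
    moreover have "P = ?f (s, M)" by (simp only: prod.case eq[symmetric])
    ultimately show "P \<in> ?f ` ?D" by (rule rev_image_eqI)
  qed
  ultimately have "bij_betw ?f ?D (difference_multisets (Suc K) S n)"
    by (rule bij_betw_imageI)
  from bij_betw_same_card[OF this] show ?thesis
    using fin finite_difference_multisets by (subst (asm) card_SigmaI) auto
qed

text \<open>Both counts obey the same recursion in \<open>K\<close>, removing
  \<open>Suc K * s\<close> with \<open>s\<close> in \<open>S\<close>, and they agree for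
  \<open>K = 0\<close>.\<close>

lemma card_difference_multisets:
  assumes "0 \<in> S" and "\<And>x y. x \<in> S \<Longrightarrow> y \<in> S \<Longrightarrow> x + y \<in> S"
  shows "card (difference_multisets K S n) = card (restricted_partitions {1..K} S n)"
proof (induction K arbitrary: n)
  case 0
  have "difference_multisets 0 S n = restricted_partitions {1..0} S n"
    by (auto simp: difference_multisets_def restricted_partitions_def)
  then show ?case by simp
next
  case (Suc K)
  have "{1..Suc K} = insert (Suc K) {1..K}" by auto
  then show ?case
    by (simp only: card_difference_multisets_Suc[OF assms] Suc,
        subst card_restricted_partitions_insert) auto
qed

lemma size_le_sum_mset:
  "\<forall>p\<in>#P. 0 < p \<Longrightarrow> size P \<le> sum_mset (P :: nat multiset)"
  by (induction P) fastforce+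

text \<open>Partitions are padded with zeros to exactly \<open>n\<close> elements.\<close>

lemma card_parts_diffs_partitions:
  assumes "0 \<in> S"
  shows "card (parts_diffs_partitions n S) = card (difference_multisets n S n)"
proof (rule bij_betw_same_card)
  let ?f = "\<lambda>P. P + replicate_mset (n - size P) (0::nat)"
  let ?g = "\<lambda>M. filter_mset (\<lambda>x. x \<noteq> (0::nat)) M"
  have count0: "count M 0 = n - size (?g M)" if "size M = n" for M
  proof -
    have "size (?g M + replicate_mset (count M 0) 0) = n"
      using that by (simp only: filter_plus_replicate_count)
    then show ?thesis by simp
  qed
  show "bij_betw ?f (parts_diffs_partitions n S) (difference_multisets n S n)"
  proof (rule bij_betw_byWitness[where f' = ?g])
    show "\<forall>P\<in>parts_diffs_partitions n S. ?g (?f P) = P"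
    proof
      fix P assume "P \<in> parts_diffs_partitions n S"
      then have "0 \<notin># P" by (auto simp: parts_diffs_partitions_def partitions_def)
      then show "?g (?f P) = P" by (intro multiset_eqI) (auto simp: not_in_iff)
    qed
    show "\<forall>M\<in>difference_multisets n S n. ?f (?g M) = M"
    proof
      fix M assume "M \<in> difference_multisets n S n"
      then have "size M = n" by (simp add: difference_multisets_def)
      from count0[OF this, symmetric] show "?f (?g M) = M"
        by (simp only: filter_plus_replicate_count)
    qed
    show "?f ` parts_diffs_partitions n S \<subseteq> difference_multisets n S n"
    proof (rule image_subsetI)
      fix P assume P: "P \<in> parts_diffs_partitions n S"
      \<comment> \<open>Positive parts make \<open>n - size P\<close> an honest subtraction. In the
        padded multiset, a difference with a zero is a part or \<open>0\<close>, which is where the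
        condition on the parts themselves enters.\<close>
      then have "size P \<le> n" using size_le_sum_mset[of P]
        by (auto simp: parts_diffs_partitions_def partitions_def)
      with P assms show "?f P \<in> difference_multisets n S n"
        by (auto simp: parts_diffs_partitions_def partitions_def difference_multisets_def split: if_splits)
    qed
    show "?g ` difference_multisets n S n \<subseteq> parts_diffs_partitions n S"
    proof (rule image_subsetI)
      fix M assume M: "M \<in> difference_multisets n S n"
      have "sum_mset (?g M + replicate_mset (count M 0) 0) = n"
        using M by (simp only: filter_plus_replicate_count) (simp add: difference_multisets_def)
      with M show "?g M \<in> parts_diffs_partitions n S"
        by (auto simp: parts_diffs_partitions_def partitions_def difference_multisets_def)
    qed
  qed
qed

section \<open>The sets (ii) and (iii) as restricted partitions\<close>

lemma mem_partition_le:
  "P \<in> partitions n \<Longrightarrow> p \<in># P \<Longrightarrow> p \<in> {1..n}"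
  using multi_member_split[of p P] by (fastforce simp: partitions_def)

text \<open>Only the parts that occur are constrained in (ii); \<open>0 \<in> S\<close> covers the
  absent ones, whose count is \<open>0\<close>.\<close>

lemma mult_partitions_eq_restricted:
  assumes "0 \<in> S"
  shows "mult_partitions n S = restricted_partitions {1..n} S n"
proof (intro equalityI subsetI)
  fix P assume P: "P \<in> mult_partitions n S"
  then have "set_mset P \<subseteq> {1..n}" using mem_partition_le by (auto simp: mult_partitions_def)
  moreover have "count P k \<in> S" for k
    using P assms by (cases "k \<in># P") (auto simp: mult_partitions_def not_in_iff)
  ultimately show "P \<in> restricted_partitions {1..n} S n"
    using P by (auto simp: mult_partitions_def restricted_partitions_def partitions_def)
next
  fix P assume "P \<in> restricted_partitions {1..n} S n"
  then show "P \<in> mult_partitions n S"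
    by (fastforce simp: mult_partitions_def restricted_partitions_def partitions_def)
qed

lemma divisible_partitions_eq_restricted:
  "divisible_partitions n m a = restricted_partitions {p \<in> {1..n}. \<exists>i\<in>{1..m}. a i dvd p} UNIV n"
proof (intro equalityI subsetI)
  fix P assume "P \<in> divisible_partitions n m a"
  then show "P \<in> restricted_partitions {p \<in> {1..n}. \<exists>i\<in>{1..m}. a i dvd p} UNIV n"
    using mem_partition_le[of P n]
    by (auto simp: divisible_partitions_def restricted_partitions_def partitions_def)
next
  fix P assume "P \<in> restricted_partitions {p \<in> {1..n}. \<exists>i\<in>{1..m}. a i dvd p} UNIV n"
  moreover from this have "p \<in> {p \<in> {1..n}. \<exists>i\<in>{1..m}. a i dvd p}" if "p \<in># P" for p
    using that unfolding restricted_partitions_def by blast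
  ultimately show "P \<in> divisible_partitions n m a"
    unfolding divisible_partitions_def restricted_partitions_def partitions_def by fastforce
qed

section \<open>Generating functions\<close>

unbundle fps_syntax

text \<open>For \<open>k > 0\<close>, the generating function of \<open>S\<close> with
  \<open>q\<close> replaced by \<open>q^k\<close>. Rational coefficients make every series with
  nonzero constant term invertible.\<close>

definition dilated_gf :: "nat set \<Rightarrow> nat \<Rightarrow> rat fps" where
  "dilated_gf S k = Abs_fps (\<lambda>n. if k dvd n \<and> n div k \<in> S then 1 else 0)"

lemma dilated_gf_nth: "dilated_gf S k $ n = (if k dvd n \<and> n div k \<in> S then 1 else 0)"
  by (simp add: dilated_gf_def)

lemma prod_dilated_gf_nth:
  assumes "finite K" "0 \<notin> K"
  shows "(\<Prod>k\<in>K. dilated_gf S k) $ n = of_nat (card (restricted_partitions K S n))"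
  using assms
proof (induction K arbitrary: n)
  case empty
  have "restricted_partitions {} S n = (if n = 0 then {{#}} else {})"
    by (auto simp: restricted_partitions_def)
  then show ?case by simp
next
  case (insert k K)
  have k: "0 < k" using insert.prems by auto
  let ?c = "\<lambda>n. of_nat (card (restricted_partitions K S n)) :: rat"
  have "(\<Prod>k\<in>insert k K. dilated_gf S k) $ n = (\<Sum>i=0..n. dilated_gf S k $ i * ?c (n - i))"
    using insert by (simp add: fps_mult_nth)
  also have "\<dots> = (\<Sum>i | i \<le> n \<and> k dvd i \<and> i div k \<in> S. ?c (n - i))"
    by (rule sum.mono_neutral_cong_right) (auto simp: dilated_gf_nth)
  also have "\<dots> = (\<Sum>s | s \<in> S \<and> k * s \<le> n. ?c (n - k * s))"
    by (rule sum.reindex_bij_witness[where i = "\<lambda>s. k * s" and j = "\<lambda>i. i div k"])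
      (use k in auto)
  also have "\<dots> = of_nat (card (restricted_partitions (insert k K) S n))"
    using insert k by (subst card_restricted_partitions_insert) auto
  finally show ?case .
qed

lemma dilated_gf_singleton_0: "0 < k \<Longrightarrow> dilated_gf {0} k = 1"
  by (rule fps_ext) (auto simp: dilated_gf_nth elim: dvdE)

text \<open>Multiplying by \<open>q^(k*c)\<close> shifts the series of \<open>T\<close> to that of
  \<open>c + T\<close>. As \<open>c + T\<close> lies inside \<open>T\<close>, the subtraction leaves
  exactly the complement.\<close>

lemma dilated_gf_mult_one_minus:
  assumes k: "0 < k" and T: "\<And>t. t \<in> T \<Longrightarrow> c + t \<in> T"
  shows "dilated_gf T k * (1 - fps_X ^ (k * c)) = dilated_gf (T - (+) c ` T) k"
proof (rule fps_ext)
  fix n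
  have "(dilated_gf T k * fps_X ^ (k * c)) $ n = dilated_gf ((+) c ` T) k $ n"
  proof (cases "k dvd n \<and> k * c \<le> n")
    case True
    then obtain q where "n = k * q" by auto
    with True k have q: "n = k * q" "c \<le> q" by auto
    have "q - c \<in> T \<longleftrightarrow> q \<in> (+) c ` T"
      using q by (auto intro: image_eqI[of _ _ "q - c"])
    then show ?thesis using q k
      by (simp add: fps_X_power_mult_right_nth dilated_gf_nth flip: diff_mult_distrib2)
  next
    case False
    have "\<not> k dvd n - k * c" if "k * c \<le> n" "\<not> k dvd n"
      using that by (metis dvd_add dvd_triv_left le_add_diff_inverse)
    with False k show ?thesis
      by (auto simp: fps_X_power_mult_right_nth dilated_gf_nth elim!: dvdE)
  qed
  then have "(dilated_gf T k * (1 - fps_X ^ (k * c))) $ n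
      = dilated_gf T k $ n - dilated_gf ((+) c ` T) k $ n"
    by (simp add: right_diff_distrib)
  also have "\<dots> = dilated_gf (T - (+) c ` T) k $ n"
    using T by (auto simp: dilated_gf_nth)
  finally show "(dilated_gf T k * (1 - fps_X ^ (k * c))) $ n = dilated_gf (T - (+) c ` T) k $ n" .
qed

section \<open>Power series truncated at degree N\<close>

text \<open>Congruence modulo \<open>q^(N+1)\<close>, which lets finite products stand in for the
  infinite products over all \<open>k\<close>.\<close>

definition eq_upto :: "nat \<Rightarrow> rat fps \<Rightarrow> rat fps \<Rightarrow> bool" where
  "eq_upto N f g \<longleftrightarrow> (\<forall>i\<le>N. f $ i = g $ i)"

lemma eq_upto_refl: "eq_upto N f f"
  by (simp add: eq_upto_def)

lemma eq_upto_sym: "eq_upto N f g \<Longrightarrow> eq_upto N g f"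
  by (simp add: eq_upto_def)

lemma eq_upto_trans [trans]: "eq_upto N f g \<Longrightarrow> eq_upto N g h \<Longrightarrow> eq_upto N f h"
  by (simp add: eq_upto_def)

lemma eq_upto_mult:
  "eq_upto N f g \<Longrightarrow> eq_upto N f' g' \<Longrightarrow> eq_upto N (f * f') (g * g')"
  by (auto simp: eq_upto_def fps_mult_nth intro!: sum.cong)

lemma eq_upto_cancel:
  assumes "eq_upto N (f * u) (g * u)" "u $ 0 \<noteq> 0"
  shows "eq_upto N f g"
proof -
  have "u * inverse u = 1" using assms(2) by (simp add: inverse_mult_eq_1')
  then show ?thesis
    using eq_upto_mult[OF assms(1) eq_upto_refl[of N "inverse u"]] by (simp add: mult.assoc)
qed

text \<open>For finite \<open>A\<close> without \<open>0\<close>, the reciprocal of the generating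
  function of partitions with parts in \<open>A\<close>. For infinite \<open>A\<close> the product
  defaults to \<open>1\<close>.\<close>

definition euler_prod :: "nat set \<Rightarrow> rat fps" where
  "euler_prod A = (\<Prod>p\<in>A. 1 - fps_X ^ p)"

lemma euler_prod_nth_0: "0 \<notin> A \<Longrightarrow> euler_prod A $ 0 = 1"
  unfolding euler_prod_def by (induction A rule: infinite_finite_induct) auto

lemma eq_upto_euler_prod_1:
  assumes "\<And>p. p \<in> A \<Longrightarrow> N < p"
  shows "eq_upto N (euler_prod A) 1"
  using assms
proof (induction A rule: infinite_finite_induct)
  case (insert p A)
  have "eq_upto N (1 - fps_X ^ p) 1"
    using insert.prems[of p] by (auto simp: eq_upto_def)
  from eq_upto_mult[OF this] insert show ?case by (simp add: euler_prod_def)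
qed (auto simp: euler_prod_def eq_upto_refl)

text \<open>The surplus factors have exponents \<open>k * c > N\<close> and are congruent to
  \<open>1\<close>.\<close>

lemma eq_upto_euler_prod_multiples:
  assumes "0 < c"
  shows "eq_upto N (\<Prod>k=1..N. 1 - fps_X ^ (k * c)) (euler_prod {p \<in> {1..N}. c dvd p})"
proof -
  let ?A = "{p \<in> {1..N}. c dvd p}" and ?B = "(\<lambda>k. k * c) ` {1..N}"
  have "?A \<subseteq> ?B"
  proof
    fix p assume "p \<in> ?A"
    then obtain k where k: "p = k * c" and p: "1 \<le> p" "p \<le> N" by (auto elim: dvdE)
    have "k \<le> k * c" using assms by simp
    then have "k \<le> N" using k p by (metis le_trans)
    moreover have "k \<noteq> 0" using k p by (cases k) auto
    ultimately show "p \<in> ?B" using k by (intro image_eqI[of _ _ k]) auto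
  qed
  then have "euler_prod ?B = euler_prod ?A * euler_prod (?B - ?A)"
    unfolding euler_prod_def by (subst prod.subset_diff[of ?A ?B]) (auto simp: mult.commute)
  moreover have "(\<Prod>k=1..N. 1 - fps_X ^ (k * c)) = euler_prod ?B"
    unfolding euler_prod_def using assms by (subst prod.reindex) (auto simp: inj_on_def)
  ultimately have eq: "(\<Prod>k=1..N. 1 - fps_X ^ (k * c)) = euler_prod ?A * euler_prod (?B - ?A)"
    by (simp only:)
  have "eq_upto N (euler_prod (?B - ?A)) 1"
    by (rule eq_upto_euler_prod_1) (use assms in auto)
  from eq_upto_mult[OF eq_upto_refl[of N "euler_prod ?A"] this] show ?thesis
    unfolding eq by (simp only: mult_1_right)
qed

section \<open>The semigroup\<close>

lemma zero_mem_gen_semigroup: "0 \<in> gen_semigroup m a"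
  unfolding gen_semigroup_def by (auto intro!: exI[of _ "\<lambda>_. 0"])

lemma gen_semigroup_add:
  assumes "s \<in> gen_semigroup m a" "t \<in> gen_semigroup m a"
  shows "s + t \<in> gen_semigroup m a"
proof -
  obtain x y where "s = (\<Sum>i=1..m. x i * a i)" "t = (\<Sum>i=1..m. y i * a i)"
    using assms by (auto simp: gen_semigroup_def)
  then have "s + t = (\<Sum>i=1..m. (x i + y i) * a i)"
    by (simp add: sum.distrib algebra_simps)
  then show ?thesis by (auto simp: gen_semigroup_def)
qed

lemma gen_semigroup_0: "gen_semigroup 0 a = {0}"
  by (auto simp: gen_semigroup_def)

lemma gen_semigroup_Suc:
  "gen_semigroup (Suc m) a = {t + x * a (Suc m) | t x. t \<in> gen_semigroup m a}"
proof (intro equalityI subsetI)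
  fix s assume "s \<in> {t + x * a (Suc m) | t x. t \<in> gen_semigroup m a}"
  then obtain x y where s: "s = (\<Sum>i=1..m. y i * a i) + x * a (Suc m)"
    by (auto simp: gen_semigroup_def)
  have "s = (\<Sum>i=1..Suc m. (y(Suc m := x)) i * a i)"
    unfolding s by (simp add: sum.cl_ivl_Suc)
  then show "s \<in> gen_semigroup (Suc m) a" unfolding gen_semigroup_def by blast
qed (auto simp: gen_semigroup_def)

lemma mult_mem_gen_semigroup:
  "j \<in> {1..m} \<Longrightarrow> x * a j \<in> gen_semigroup m a"
proof (induction m)
  case (Suc m)
  show ?case
  proof (cases "j = Suc m")
    case True
    then show ?thesis using zero_mem_gen_semigroup[of m a]
      unfolding gen_semigroup_Suc by force
  next
    case False
    with Suc have "x * a j + 0 * a (Suc m) \<in> gen_semigroup (Suc m) a"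
      unfolding gen_semigroup_Suc by fastforce
    then show ?thesis by simp
  qed
qed auto

lemma Gcd_dvd_gen_semigroup:
  "s \<in> gen_semigroup m a \<Longrightarrow> Gcd (a ` {1..m}) dvd s"
  by (auto simp: gen_semigroup_def simp del: Gcd_dvd intro!: dvd_sum dvd_mult Gcd_dvd[OF imageI])

lemma gen_semigroup_add_last:
  "t \<in> gen_semigroup (Suc m) a \<Longrightarrow> a (Suc m) + t \<in> gen_semigroup (Suc m) a"
  using gen_semigroup_add mult_mem_gen_semigroup[of "Suc m" "Suc m" 1 a] by auto

lemma gen_semigroup_1_diff:
  assumes "0 < a 1"
  shows "gen_semigroup 1 a - (+) (a 1) ` gen_semigroup 1 a = {0}"
proof -
  have S1: "gen_semigroup 1 a = range (\<lambda>x. x * a 1)"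
    using gen_semigroup_Suc[of 0 a] by (auto simp: gen_semigroup_0)
  have "x = 0" if "x * a 1 \<notin> (+) (a 1) ` range (\<lambda>x. x * a 1)" for x
    using that by (cases x) auto
  with assms show ?thesis unfolding S1 by auto
qed

text \<open>An element outside the shift by the new generator \<open>c\<close> uses no copy of
  \<open>c\<close>, and it avoids \<open>l + S\<close> since \<open>l\<close> is a positive multiple
  of \<open>c\<close>. Conversely, if \<open>s\<close> and \<open>t\<close> lie in the old semigroup
  and \<open>s - t\<close> is a positive multiple of \<open>c\<close>, the gcd form of
  \<open>l\<close> shows that \<open>l\<close> divides \<open>s - t\<close>. The form
  \<open>lcm (a j) c\<close> puts all multiples of \<open>l\<close> in the old semigroup, so
  \<open>s\<close> lies in \<open>l + S\<close>.\<close>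

lemma gen_semigroup_Suc_diff:
  assumes l: "l = lcm (Gcd (a ` {1..m})) (a (Suc m))" "l = lcm (a j) (a (Suc m))"
    and j: "j \<in> {1..m}" and pos: "0 < a j" "0 < a (Suc m)"
  shows "gen_semigroup (Suc m) a - (+) (a (Suc m)) ` gen_semigroup (Suc m) a
       = gen_semigroup m a - (+) l ` gen_semigroup m a"
    (is "?S' - (+) ?c ` ?S' = ?S - (+) l ` ?S")
proof -
  have l0: "0 < l" using l(2) pos by (simp add: lcm_pos_nat)
  have mulS: "y * l \<in> ?S" for y
  proof -
    obtain z where "l = a j * z" using l(2) by (metis dvd_lcm1 dvdE)
    then show ?thesis
      using mult_mem_gen_semigroup[OF j, of "y * z" a] by (simp add: algebra_simps)
  qed
  \<comment> \<open>Writing the cofactor as \<open>Suc w\<close> lets one copy of the generator be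
    split off: \<open>l + u = ?c + (u + w * ?c)\<close>.\<close>
  obtain w where "l = ?c * w" using l(1) by (metis dvd_lcm2 dvdE)
  with l0 obtain w where w: "l = ?c * Suc w" by (cases w) auto
  show ?thesis
  proof (intro equalityI subsetI)
    fix s assume s: "s \<in> ?S' - (+) ?c ` ?S'"
    then obtain t x where tx: "s = t + x * ?c" "t \<in> ?S" by (auto simp: gen_semigroup_Suc)
    have "x = 0"
    proof (rule ccontr)
      assume "x \<noteq> 0"
      then obtain y where "s = ?c + (t + y * ?c)" using tx by (cases x) auto
      moreover have "t + y * ?c \<in> ?S'" using tx by (auto simp: gen_semigroup_Suc)
      ultimately show False using s by blast
    qed
    moreover have "s \<notin> (+) l ` ?S"
    proof
      assume "s \<in> (+) l ` ?S"
      then obtain u where "u \<in> ?S" "s = ?c + (u + w * ?c)" using w by (auto simp: algebra_simps)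
      moreover have "u + w * ?c \<in> ?S'" using \<open>u \<in> ?S\<close> by (auto simp: gen_semigroup_Suc)
      ultimately show False using s by blast
    qed
    ultimately show "s \<in> ?S - (+) l ` ?S" using tx by simp
  next
    fix s assume s: "s \<in> ?S - (+) l ` ?S"
    then have "s + 0 * ?c \<in> ?S'" unfolding gen_semigroup_Suc by blast
    moreover have "s \<notin> (+) ?c ` ?S'"
    proof
      assume "s \<in> (+) ?c ` ?S'"
      then obtain t x where tx: "s = t + Suc x * ?c" "t \<in> ?S"
        by (auto simp: gen_semigroup_Suc)
      \<comment> \<open>The gcd divides both \<open>s\<close> and \<open>t\<close>, which lie in the
        old semigroup.\<close>
      have "Gcd (a ` {1..m}) dvd Suc x * ?c"
        using Gcd_dvd_gen_semigroup[of _ m a] tx s by (metis DiffD1 dvd_add_right_iff)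
      then have "l dvd Suc x * ?c" unfolding l(1) by (intro lcm_least) auto
      then obtain y where y: "Suc x * ?c = l * y" by (auto elim: dvdE)
      moreover have "Suc x * ?c \<noteq> 0" using pos by simp
      ultimately obtain z where "y = Suc z" by (cases y) auto
      then have "s = l + (t + z * l)" using y tx by (simp add: algebra_simps)
      moreover have "t + z * l \<in> ?S" using tx mulS gen_semigroup_add by blast
      ultimately show False using s by blast
    qed
    ultimately show "s \<in> ?S' - (+) ?c ` ?S'" by simp
  qed
qed

section \<open>The product identity, adjoining one generator at a time\<close>

lemma prod_dilated_gf_mult:
  assumes "\<And>t. t \<in> T \<Longrightarrow> c + t \<in> T"
  shows "(\<Prod>k=1..N. dilated_gf T k) * (\<Prod>k=1..N. 1 - fps_X ^ (k * c))
       = (\<Prod>k=1..N. dilated_gf (T - (+) c ` T) k)"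
  unfolding prod.distrib[symmetric] using assms
  by (intro prod.cong dilated_gf_mult_one_minus) auto

text \<open>Induction on the number \<open>i\<close> of generators used, with \<open>m\<close> and
  the condition fixed. It starts at \<open>1\<close> because the condition only speaks of indices
  from \<open>2\<close> on.\<close>

lemma semigroup_gf_mult_euler_prod:
  assumes "1 \<le> i" "i \<le> m" and pos: "\<forall>i\<in>{1..m}. 0 < a i" and cond: "lcm_gcd_condition m a"
  shows "eq_upto N ((\<Prod>k=1..N. dilated_gf (gen_semigroup i a) k)
           * euler_prod {p \<in> {1..N}. \<exists>j\<in>{1..i}. a j dvd p}) 1"
  using assms(1,2)
proof (induction i rule: nat_induct_at_least)
  case base
  then have a1: "0 < a 1" using pos by auto
  let ?G = "\<Prod>k=1..N. dilated_gf (gen_semigroup 1 a) k"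
  have "?G * (\<Prod>k=1..N. 1 - fps_X ^ (k * a 1))
      = (\<Prod>k=1..N. dilated_gf (gen_semigroup 1 a - (+) (a 1) ` gen_semigroup 1 a) k)"
    using gen_semigroup_add_last[of _ 0 a] by (intro prod_dilated_gf_mult) auto
  also have "\<dots> = 1"
    unfolding gen_semigroup_1_diff[of a, OF a1] by (intro prod.neutral) (auto simp: dilated_gf_singleton_0)
  finally have "?G * (\<Prod>k=1..N. 1 - fps_X ^ (k * a 1)) = 1" .
  with eq_upto_mult[OF eq_upto_refl[of N ?G] eq_upto_euler_prod_multiples[OF a1, of N]]
  show ?case by (simp add: eq_upto_sym)
next
  case (Suc i)
  define c where "c = a (Suc i)"
  define l where "l = lcm (Gcd (a ` {1..i})) c"
  have "Suc i \<in> {2..m}" and "{1..<Suc i} = {1..i}" using Suc by auto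
  with cond obtain j where j: "j \<in> {1..i}" "l = lcm (a j) c"
    unfolding lcm_gcd_condition_def l_def c_def by metis
  have c: "0 < c" and aj: "0 < a j" using pos Suc j by (auto simp: c_def)
  have l: "0 < l" using c aj j by (simp add: lcm_pos_nat)
  let ?S = "gen_semigroup i a" and ?S' = "gen_semigroup (Suc i) a"
  let ?G = "\<Prod>k=1..N. dilated_gf ?S k" and ?G' = "\<Prod>k=1..N. dilated_gf ?S' k"
  define U where "U = {p \<in> {1..N}. \<exists>j\<in>{1..i}. a j dvd p}"
  define U' where "U' = {p \<in> {1..N}. \<exists>j\<in>{1..Suc i}. a j dvd p}"
  define A where "A = {p \<in> {1..N}. c dvd p}"
  define L where "L = {p \<in> {1..N}. l dvd p}"
  \<comment> \<open>The gcd form of \<open>l\<close> shows that a common multiple of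
    \<open>c\<close> and any earlier generator is a multiple of \<open>l\<close>; the form
    \<open>lcm (a j) c\<close> gives the converse. Hence \<open>U \<inter> A = L\<close>.\<close>
  have "l dvd p" if "j' \<in> {1..i}" "a j' dvd p" "c dvd p" for j' p
    unfolding l_def using that by (intro lcm_least) (auto intro: dvd_trans Gcd_dvd)
  moreover have "a j dvd p" "c dvd p" if "l dvd p" for p
    using that unfolding j(2) by (auto intro: dvd_trans)
  ultimately have "U \<inter> A = L" using j(1) unfolding U_def A_def L_def by blast
  moreover have "{1..Suc i} = insert (Suc i) {1..i}" by auto
  then have "U \<union> A = U'" unfolding U_def A_def U'_def c_def by auto
  moreover have "finite U" "finite A" by (auto simp: U_def A_def)
  ultimately have UA: "euler_prod U' * euler_prod L = euler_prod U * euler_prod A"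
    unfolding euler_prod_def by (metis prod.union_inter)
  have "(+) l t \<in> ?S" if "t \<in> ?S" for t
  proof -
    obtain x where "l = x * a j" using j(2) by (metis dvd_lcm1 dvdE mult.commute)
    then show ?thesis using gen_semigroup_add mult_mem_gen_semigroup[OF j(1)] that by auto
  qed
  \<comment> \<open>Both sides are the product over \<open>k\<close> of the dilated series of one
    and the same difference set.\<close>
  then have GG': "?G' * (\<Prod>k=1..N. 1 - fps_X ^ (k * c)) = ?G * (\<Prod>k=1..N. 1 - fps_X ^ (k * l))"
    using prod_dilated_gf_mult[of ?S' c] prod_dilated_gf_mult[of ?S l]
      gen_semigroup_add_last[of _ i a] gen_semigroup_Suc_diff[of l a i j] j c aj
    by (simp add: l_def c_def)
  have "eq_upto N (?G' * euler_prod A) (?G' * (\<Prod>k=1..N. 1 - fps_X ^ (k * c)))"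
    unfolding A_def
    by (intro eq_upto_mult eq_upto_refl eq_upto_sym[OF eq_upto_euler_prod_multiples] c)
  also have "eq_upto N \<dots> (?G * euler_prod L)"
    unfolding GG' L_def by (intro eq_upto_mult eq_upto_refl eq_upto_euler_prod_multiples l)
  \<comment> \<open>The extra factor \<open>euler_prod U\<close> lets \<open>UA\<close> trade
    \<open>U\<close> and \<open>A\<close> for \<open>U'\<close> and \<open>L\<close>, and turns
    \<open>?G\<close> into \<open>1\<close> by the induction hypothesis. Then
    \<open>euler_prod L\<close>, with constant term \<open>1\<close>, cancels.\<close>
  finally have "eq_upto N (?G' * euler_prod A * euler_prod U) (?G * euler_prod L * euler_prod U)"
    by (rule eq_upto_mult[OF _ eq_upto_refl])
  then have "eq_upto N (?G' * euler_prod U' * euler_prod L) (?G * euler_prod U * euler_prod L)"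
    by (simp only: mult.assoc UA mult.commute[of "euler_prod A"] mult.commute[of "euler_prod L"])
  also have "eq_upto N \<dots> (1 * euler_prod L)"
    using Suc unfolding U_def by (intro eq_upto_mult eq_upto_refl) auto
  finally have "eq_upto N (?G' * euler_prod U') 1"
    by (rule eq_upto_cancel) (simp add: euler_prod_nth_0 L_def)
  then show ?case by (simp add: U'_def)
qed

text \<open>The geometric series, as the case \<open>T = UNIV\<close>, \<open>c = 1\<close> of the
  shift identity.\<close>

lemma dilated_gf_UNIV: "0 < k \<Longrightarrow> dilated_gf UNIV k * (1 - fps_X ^ k) = 1"
proof -
  assume k: "0 < k"
  have "UNIV - (+) (1::nat) ` UNIV = {0}"
  proof -
    have "x \<in> range Suc" if "x \<noteq> 0" for x using that by (cases x) auto
    then show ?thesis by auto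
  qed
  then show ?thesis
    using dilated_gf_mult_one_minus[of k UNIV 1] k by (simp add: dilated_gf_singleton_0)
qed

text \<open>Up to degree \<open>n\<close>, both generating functions are inverse to the same Euler
  product, so their coefficients at \<open>n\<close> agree.\<close>

lemma card_mult_partitions_eq_divisible:
  assumes "1 \<le> m" "\<forall>i\<in>{1..m}. 0 < a i" "lcm_gcd_condition m a"
  shows "card (mult_partitions n (gen_semigroup m a)) = card (divisible_partitions n m a)"
proof -
  let ?U = "{p \<in> {1..n}. \<exists>i\<in>{1..m}. a i dvd p}"
  let ?G = "\<Prod>k=1..n. dilated_gf (gen_semigroup m a) k"
  let ?D = "\<Prod>k\<in>?U. dilated_gf UNIV k"
  have "?D * euler_prod ?U = 1"
    unfolding euler_prod_def prod.distrib[symmetric]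
    by (intro prod.neutral) (auto simp: dilated_gf_UNIV)
  then have "eq_upto n (?G * euler_prod ?U) (?D * euler_prod ?U)"
    using semigroup_gf_mult_euler_prod[OF assms(1) order_refl assms(2,3), of n] by simp
  then have "eq_upto n ?G ?D"
    by (rule eq_upto_cancel) (simp add: euler_prod_nth_0)
  then have "?G $ n = ?D $ n" by (simp add: eq_upto_def)
  then show ?thesis
    by (simp add: prod_dilated_gf_nth divisible_partitions_eq_restricted
        mult_partitions_eq_restricted[OF zero_mem_gen_semigroup])
qed

theorem theorem2:
  fixes n m :: nat and a :: "nat \<Rightarrow> nat"
  assumes "0 < n" and "1 \<le> m" and "\<forall>i\<in>{1..m}. 0 < a i"
  shows "card (parts_diffs_partitions n (gen_semigroup m a)) =
           card (mult_partitions n (gen_semigroup m a)) \<and>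
         (lcm_gcd_condition m a \<longrightarrow>
           card (parts_diffs_partitions n (gen_semigroup m a)) =
             card (divisible_partitions n m a) \<and>
           card (mult_partitions n (gen_semigroup m a)) =
             card (divisible_partitions n m a))"
proof -
  have "card (parts_diffs_partitions n (gen_semigroup m a)) =
      card (mult_partitions n (gen_semigroup m a))"
    by (simp only: card_parts_diffs_partitions[OF zero_mem_gen_semigroup]
        card_difference_multisets[OF zero_mem_gen_semigroup gen_semigroup_add]
        mult_partitions_eq_restricted[OF zero_mem_gen_semigroup])
  with card_mult_partitions_eq_divisible[OF assms(2,3)] show ?thesis by auto
qed

end
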